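(* For all Boolean algebras $\mathbb{B}_0,\mathbb{B}_1$, \[\mathrm{irr}(\mathbb{B}_0\times\mathbb{B}_1)=\max\{\mathrm{irr}(\mathbb{B}_0),\mathrm{irr}(\mathbb{B}_1)\}.\]
   Context: $\mathbb{B}_0\times\mathbb{B}_1$ is the product Boolean algebra (coordinatewise operations). For a Boolean algebra $\mathbb{B}$, a subset $X\subseteq\mathbb{B}$ is irredundant if for every $x\in X$, $x\notin\langle X\setminus\{x\}\rangle_{\mathbb{B}}$ (the subalgebra generated by $X\setminus\{x\}$); $\mathrm{irr}(\mathbb{B})$ is the supremum of the cardinalities of irredundant subsets of $\mathbb{B}$.
   Formalization: The formal theorem assumes that at least one of the two Boolean algebras is infinite; for two nontrivial finite algebras the claim fails, e.g. irr(2)=0 for the two-element algebra 2, but {(1,0)} is irredundant in 2×2. *)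

theory Defs
  imports "HOL.Hull" "HOL-Library.Product_Order"
begin

unbundle cardinal_syntax

text \<open>
  Boolean algebras are types of class \<^class>\<open>boolean_algebra\<close>; the one-element algebra
  is included. \<^theory>\<open>HOL-Library.Product_Order\<close> equips the product of two such
  types with the coordinatewise operations.
\<close>

definition subalgebra :: "'a::boolean_algebra set \<Rightarrow> bool" where
  "subalgebra S \<longleftrightarrow> bot \<in> S \<and> top \<in> S \<and> (\<forall>x\<in>S. - x \<in> S) \<and>
     (\<forall>x\<in>S. \<forall>y\<in>S. inf x y \<in> S \<and> sup x y \<in> S)"

definition irredundant :: "'a::boolean_algebra set \<Rightarrow> bool" where
  "irredundant X \<longleftrightarrow> (\<forall>x\<in>X. x \<notin> subalgebra hull (X - {x}))"

text \<open>
  Cardinals are represented by cardinal orders, which are determined only up to \<open>=o\<close>.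
  The supremum of the cardinalities of a family of subsets of a type is again the cardinality of
  some subset of that type, so it can be taken among the relations on the same type;
  \<open>card_sup_least\<close> shows that it is least among upper bounds on arbitrary types.
\<close>

definition is_card_sup :: "'a set set \<Rightarrow> 'a rel \<Rightarrow> bool" where
  "is_card_sup \<A> r \<longleftrightarrow> Card_order r \<and> (\<forall>A\<in>\<A>. |A| \<le>o r) \<and>
     (\<forall>s :: 'a rel. Card_order s \<and> (\<forall>A\<in>\<A>. |A| \<le>o s) \<longrightarrow> r \<le>o s)"

definition card_sup :: "'a set set \<Rightarrow> 'a rel" where
  "card_sup \<A> = (SOME r. is_card_sup \<A> r)"

lemma is_card_sup_card_sup: "is_card_sup \<A> (card_sup \<A>)"
proof -
  let ?R = "{s :: 'a rel. Card_order s \<and> (\<forall>A\<in>\<A>. |A| \<le>o s)}"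
  have "|UNIV :: 'a set| \<in> ?R"
    by (simp add: card_of_Card_order card_of_mono1)
  then have "?R \<noteq> {}" by blast
  moreover have "\<forall>r\<in>?R. Well_order r"
    by (simp add: card_order_on_def)
  ultimately obtain r where "r \<in> ?R" "\<forall>s\<in>?R. r \<le>o s"
    using exists_minim_Well_order[of ?R] by blast
  then have "is_card_sup \<A> r" by (auto simp: is_card_sup_def)
  then show ?thesis unfolding card_sup_def by (rule someI)
qed

lemma Card_order_card_sup: "Card_order (card_sup \<A>)"
  using is_card_sup_card_sup[of \<A>] by (simp add: is_card_sup_def)

lemma card_sup_upper: "A \<in> \<A> \<Longrightarrow> |A| \<le>o card_sup \<A>"
  using is_card_sup_card_sup[of \<A>] by (simp add: is_card_sup_def)

lemma card_sup_least:
  fixes \<A> :: "'a set set" and s :: "'b rel"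
  assumes "Card_order s" and "\<And>A. A \<in> \<A> \<Longrightarrow> |A| \<le>o s"
  shows "card_sup \<A> \<le>o s"
proof (rule ccontr)
  assume "\<not> card_sup \<A> \<le>o s"
  moreover have "Well_order s" "Well_order (card_sup \<A>)"
    using assms(1) Card_order_card_sup[of \<A>] by (simp_all add: card_order_on_def)
  ultimately have less: "s <o card_sup \<A>"
    by (simp add: not_ordLeq_iff_ordLess)
  then have "s \<le>o card_sup \<A>"
    by (rule ordLess_imp_ordLeq)
  then obtain p :: "'a rel" where p: "s =o p" "p \<le>o card_sup \<A>"
    using internalize_ordLeq[of s "card_sup \<A>"] by blast
  have "Card_order p"
    using assms(1) p(1) by (rule Card_order_ordIso2)
  moreover have "\<forall>A\<in>\<A>. |A| \<le>o p"
    using assms(2) p(1) ordLeq_ordIso_trans by blast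
  ultimately have "card_sup \<A> \<le>o p"
    using is_card_sup_card_sup[of \<A>] by (simp add: is_card_sup_def)
  then have "card_sup \<A> \<le>o s"
    using p(1) ordIso_symmetric ordLeq_ordIso_trans by blast
  with less show False
    using not_ordLess_ordLeq by blast
qed

definition irr :: "'a::boolean_algebra itself \<Rightarrow> 'a rel" where
  "irr TYPE('a) = card_sup {X. irredundant X}"

text \<open>
  The maximum of two cardinals on possibly different types, the larger one being copied into the
  disjoint sum type.
\<close>

definition card_max :: "'a rel \<Rightarrow> 'b rel \<Rightarrow> ('a + 'b) rel" where
  "card_max r s = (if r \<le>o s then |Inr ` Field s| else |Inl ` Field r| )"

lemma card_max_ordIso:
  assumes "Card_order r" and "Card_order s"
  shows "r \<le>o s \<Longrightarrow> card_max r s =o s" and "s \<le>o r \<Longrightarrow> card_max r s =o r"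
proof -
  have "|Field r| =o |Inl ` Field r :: ('a + 'b) set|"
    by (rule card_of_ordIsoI[of Inl]) (simp add: bij_betw_def)
  then have l: "|Inl ` Field r :: ('a + 'b) set| =o r"
    using assms(1) card_of_Field_ordIso ordIso_symmetric ordIso_transitive by blast
  have "|Field s| =o |Inr ` Field s :: ('a + 'b) set|"
    by (rule card_of_ordIsoI[of Inr]) (simp add: bij_betw_def)
  then have r: "|Inr ` Field s :: ('a + 'b) set| =o s"
    using assms(2) card_of_Field_ordIso ordIso_symmetric ordIso_transitive by blast
  show "card_max r s =o s" if "r \<le>o s"
    using that r by (simp add: card_max_def)
  show "card_max r s =o r" if sr: "s \<le>o r"
  proof (cases "r \<le>o s")
    case True
    with sr have "s =o r" by (simp add: ordIso_iff_ordLeq)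
    with r have "|Inr ` Field s :: ('a + 'b) set| =o r"
      by (rule ordIso_transitive)
    with True show ?thesis by (simp add: card_max_def)
  next
    case False
    with l show ?thesis by (simp add: card_max_def)
  qed
qed

end

theory Submission
  imports Defs
begin

text \<open>
  Let \<open>X\<close> be irredundant in the product and write \<open>S x\<close> for the subalgebra generated by
  \<open>X - {x}\<close>. The elements \<open>x\<close> with \<open>snd x \<notin> snd ` S x\<close> project to an irredundant set of the second
  factor. For each remaining \<open>x\<close> pick \<open>d x \<in> S x\<close> with \<open>snd (d x) = snd x\<close>, and let \<open>g x\<close> be the
  symmetric difference of \<open>x\<close> and \<open>d x\<close>, so that \<open>snd (g x) = bot\<close>.

  If \<open>(top, bot)\<close> is generated by a finite \<open>F \<subseteq> X\<close>, then elements of the product can be assembled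
  from their coordinates inside \<open>S x\<close> for all \<open>x \<notin> F\<close>, so the remaining elements outside \<open>F\<close> project to
  an irredundant set of the first factor. Otherwise, each \<open>d x\<close> is generated by a finite subset of
  \<open>X - {x}\<close>; if there are too many remaining elements, then equally many of them, forming a set \<open>Y\<close>,
  satisfy \<open>g y \<in> S x\<close> for all distinct \<open>x, y \<in> Y\<close>, because a set mapping with finite values has a large
  free set. The elements \<open>fst (g x)\<close> for \<open>x \<in> Y\<close> are irredundant: if \<open>h\<close> is generated by the other \<open>g y\<close>
  and \<open>fst h = fst (g x)\<close>, then \<open>snd h\<close> is \<open>bot\<close> or \<open>top\<close>; in the first case \<open>h = g x\<close> and \<open>x \<in> S x\<close>,
  in the second \<open>h\<close> and \<open>g x\<close> differ exactly by \<open>(bot, top)\<close>.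
\<close>

section \<open>Generated subalgebras\<close>

lemma subalgebra_hull: "subalgebra (subalgebra hull X)"
  by (rule hull_in) (auto simp: subalgebra_def)

lemma subalgebraI:
  assumes "bot \<in> S" "top \<in> S" "\<And>x. x \<in> S \<Longrightarrow> - x \<in> S"
    "\<And>x y. x \<in> S \<Longrightarrow> y \<in> S \<Longrightarrow> inf x y \<in> S" "\<And>x y. x \<in> S \<Longrightarrow> y \<in> S \<Longrightarrow> sup x y \<in> S"
  shows "subalgebra S"
  using assms by (auto simp: subalgebra_def)

lemma subalgebra_closed:
  assumes "subalgebra S"
  shows "bot \<in> S" "top \<in> S" "x \<in> S \<Longrightarrow> - x \<in> S"
    "x \<in> S \<Longrightarrow> y \<in> S \<Longrightarrow> inf x y \<in> S" "x \<in> S \<Longrightarrow> y \<in> S \<Longrightarrow> sup x y \<in> S"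
  using assms by (auto simp: subalgebra_def)

lemma subalgebra_vimage_fst:
  assumes "subalgebra S"
  shows "subalgebra (fst -` S)"
  using assms by (auto simp: subalgebra_def)

lemma subalgebra_vimage_snd:
  assumes "subalgebra S"
  shows "subalgebra (snd -` S)"
  using assms by (auto simp: subalgebra_def)

lemma subalgebra_image_fst:
  assumes "subalgebra S"
  shows "subalgebra (fst ` S)"
proof (rule subalgebraI)
  show "bot \<in> fst ` S" "top \<in> fst ` S"
    using subalgebra_closed(1,2)[OF assms] by (force intro: rev_image_eqI)+
next
  fix x assume "x \<in> fst ` S"
  then show "- x \<in> fst ` S"
    using subalgebra_closed(3)[OF assms] by (force intro: rev_image_eqI)
next
  fix x y assume "x \<in> fst ` S" "y \<in> fst ` S"
  then obtain a b where "a \<in> S" "b \<in> S" "x = fst a" "y = fst b" by auto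
  then show "inf x y \<in> fst ` S" "sup x y \<in> fst ` S"
    using subalgebra_closed(4,5)[OF assms, of a b]
    by (metis fst_inf imageI, metis fst_sup imageI)
qed

lemma subalgebra_image_snd:
  assumes "subalgebra S"
  shows "subalgebra (snd ` S)"
proof (rule subalgebraI)
  show "bot \<in> snd ` S" "top \<in> snd ` S"
    using subalgebra_closed(1,2)[OF assms] by (force intro: rev_image_eqI)+
next
  fix x assume "x \<in> snd ` S"
  then show "- x \<in> snd ` S"
    using subalgebra_closed(3)[OF assms] by (force intro: rev_image_eqI)
next
  fix x y assume "x \<in> snd ` S" "y \<in> snd ` S"
  then obtain a b where "a \<in> S" "b \<in> S" "x = snd a" "y = snd b" by auto
  then show "inf x y \<in> snd ` S" "sup x y \<in> snd ` S"
    using subalgebra_closed(4,5)[OF assms, of a b]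
    by (metis snd_inf imageI, metis snd_sup imageI)
qed

lemma hull_image_fst_subset: "subalgebra hull (fst ` X) \<subseteq> fst ` (subalgebra hull X)"
  by (intro hull_minimal image_mono hull_subset subalgebra_image_fst subalgebra_hull)

lemma hull_image_snd_subset: "subalgebra hull (snd ` X) \<subseteq> snd ` (subalgebra hull X)"
  by (intro hull_minimal image_mono hull_subset subalgebra_image_snd subalgebra_hull)

text \<open>The elements with a finite support form a subalgebra, since two supports have a finite
  union. It contains \<open>X\<close>, hence the whole hull.\<close>

lemma hull_finite_support:
  assumes "x \<in> subalgebra hull X"
  obtains F where "finite F" "F \<subseteq> X" "x \<in> subalgebra hull F"
proof -
  let ?S = "{x. \<exists>F. finite F \<and> F \<subseteq> X \<and> x \<in> subalgebra hull F}"
  have "subalgebra ?S"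
  proof (rule subalgebraI)
    show "bot \<in> ?S" "top \<in> ?S"
      using subalgebra_closed(1,2)[OF subalgebra_hull] by blast+
  next
    fix x assume "x \<in> ?S"
    then show "- x \<in> ?S"
      using subalgebra_closed(3)[OF subalgebra_hull] by blast
  next
    fix x y assume "x \<in> ?S" "y \<in> ?S"
    then obtain F G where F: "finite F" "F \<subseteq> X" "x \<in> subalgebra hull F"
      and G: "finite G" "G \<subseteq> X" "y \<in> subalgebra hull G" by blast
    have "x \<in> subalgebra hull (F \<union> G)" "y \<in> subalgebra hull (F \<union> G)"
      using F(3) G(3) hull_mono[of _ "F \<union> G" subalgebra] by blast+
    then have "inf x y \<in> subalgebra hull (F \<union> G)" "sup x y \<in> subalgebra hull (F \<union> G)"
      by (simp_all add: subalgebra_closed[OF subalgebra_hull])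
    moreover have "finite (F \<union> G)" "F \<union> G \<subseteq> X"
      using F G by auto
    ultimately show "inf x y \<in> ?S" "sup x y \<in> ?S" by blast+
  qed
  moreover have "X \<subseteq> ?S"
    by (auto intro!: exI[of _ "{_}"] hull_inc)
  ultimately have "subalgebra hull X \<subseteq> ?S"
    by (intro hull_minimal)
  with assms that show thesis by blast
qed

text \<open>Addition of the associated Boolean ring. Any subalgebra containing \<open>d\<close> and
  \<open>bxor x d\<close> contains \<open>x\<close>, so \<open>x\<close> can be traded for a
  difference that vanishes in one coordinate.\<close>

definition bxor :: "'a::boolean_algebra \<Rightarrow> 'a \<Rightarrow> 'a" where
  "bxor x y = sup (inf x (- y)) (inf (- x) y)"

interpretation bxor: abstract_boolean_algebra_sym_diff inf sup uminus bot top bxor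
  by unfold_locales (simp add: bxor_def)

lemma fst_bxor: "fst (bxor x y) = bxor (fst x) (fst y)"
  and snd_bxor: "snd (bxor x y) = bxor (snd x) (snd y)"
  by (simp_all add: bxor_def)

lemma subalgebra_bxor: "subalgebra S \<Longrightarrow> x \<in> S \<Longrightarrow> y \<in> S \<Longrightarrow> bxor x y \<in> S"
  by (simp add: bxor_def subalgebra_closed)

section \<open>Irredundant sets\<close>

text \<open>Removing the index \<open>x\<close> rather than the value \<open>f x\<close> makes
  injectivity automatic: if \<open>f y = f x\<close> for another index \<open>y\<close>, then
  \<open>f x\<close> would be one of the generators.\<close>

lemma irredundant_image:
  assumes "\<And>x. x \<in> Y \<Longrightarrow> f x \<notin> subalgebra hull (f ` (Y - {x}))"
  shows "inj_on f Y" "irredundant (f ` Y)"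
proof -
  show inj: "inj_on f Y"
  proof (rule inj_onI, rule ccontr)
    fix x y assume "x \<in> Y" "y \<in> Y" "f x = f y" "x \<noteq> y"
    then have "f x \<in> f ` (Y - {x})" by auto
    with assms[OF \<open>x \<in> Y\<close>] show False by (blast intro: hull_inc)
  qed
  have "f ` Y - {f x} = f ` (Y - {x})" if "x \<in> Y" for x
    using inj that by (auto simp: inj_on_def)
  then show "irredundant (f ` Y)"
    using assms by (auto simp: irredundant_def)
qed

lemma irredundant_card_le_irr:
  fixes X :: "'a::boolean_algebra set"
  assumes "irredundant X"
  shows "|X| \<le>o irr TYPE('a)"
  using assms by (auto simp: irr_def intro: card_sup_upper)

lemma card_le_irr:
  fixes f :: "'c \<Rightarrow> 'a::boolean_algebra"
  assumes "\<And>x. x \<in> Y \<Longrightarrow> f x \<notin> subalgebra hull (f ` (Y - {x}))"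
  shows "|Y| \<le>o irr TYPE('a)"
proof -
  have "|Y| \<le>o |f ` Y|"
    using irredundant_image(1)[of Y f] assms card_of_ordLeqI by blast
  also have "|f ` Y| \<le>o irr TYPE('a)"
    using assms by (intro irredundant_card_le_irr irredundant_image(2))
  finally show ?thesis .
qed

lemma Card_order_irr: "Card_order (irr TYPE('a::boolean_algebra))"
  by (simp add: irr_def Card_order_card_sup)

text \<open>Embed by \<open>(x, bot)\<close>: a dependence among the images would project under
  \<open>fst\<close> to one in the factor.\<close>

lemma irr_fst_le: "irr TYPE('a::boolean_algebra) \<le>o irr TYPE('a \<times> 'b::boolean_algebra)"
  unfolding irr_def[where 'a = 'a]
proof (rule card_sup_least[OF Card_order_irr])
  fix X :: "'a set" assume "X \<in> {X. irredundant X}"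
  then have X: "x \<notin> subalgebra hull (X - {x})" if "x \<in> X" for x
    using that by (auto simp: irredundant_def)
  show "|X| \<le>o irr TYPE('a \<times> 'b)"
  proof (rule card_le_irr[where f = "\<lambda>x. (x, bot)"], rule notI)
    fix x assume x: "x \<in> X" and "(x, bot::'b) \<in> subalgebra hull ((\<lambda>x. (x, bot)) ` (X - {x}))"
    moreover have "subalgebra hull ((\<lambda>x. (x, bot::'b)) ` (X - {x})) \<subseteq> fst -` (subalgebra hull (X - {x}))"
      by (intro hull_minimal subalgebra_vimage_fst subalgebra_hull) (auto intro: hull_inc)
    ultimately show False using X[OF x] by auto
  qed
qed

lemma irr_snd_le: "irr TYPE('b::boolean_algebra) \<le>o irr TYPE('a::boolean_algebra \<times> 'b)"
  unfolding irr_def[where 'a = 'b]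
proof (rule card_sup_least[OF Card_order_irr])
  fix X :: "'b set" assume "X \<in> {X. irredundant X}"
  then have X: "x \<notin> subalgebra hull (X - {x})" if "x \<in> X" for x
    using that by (auto simp: irredundant_def)
  show "|X| \<le>o irr TYPE('a \<times> 'b)"
  proof (rule card_le_irr[where f = "\<lambda>x. (bot, x)"], rule notI)
    fix x assume x: "x \<in> X" and "(bot::'a, x) \<in> subalgebra hull (Pair bot ` (X - {x}))"
    moreover have "subalgebra hull (Pair (bot::'a) ` (X - {x})) \<subseteq> snd -` (subalgebra hull (X - {x}))"
      by (intro hull_minimal subalgebra_vimage_snd subalgebra_hull) (auto intro: hull_inc)
    ultimately show False using X[OF x] by auto
  qed
qed

section \<open>Infinite algebras have infinite irredundance\<close>

text \<open>Meeting with \<open>a\<close> is a homomorphism onto the algebra of elements below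
  \<open>a\<close>; the set is the preimage of the image of \<open>S\<close> under it.\<close>

lemma subalgebra_relative:
  assumes "subalgebra S"
  shows "subalgebra {x. \<exists>s\<in>S. inf x a = inf s a}" (is "subalgebra ?T")
proof (rule subalgebraI)
  show "bot \<in> ?T" "top \<in> ?T"
    using subalgebra_closed(1,2)[OF assms] by blast+
next
  fix x assume "x \<in> ?T"
  then obtain s where s: "s \<in> S" "inf x a = inf s a" by blast
  \<comment> \<open>The part of a complement below \<open>a\<close> depends only on the part of
    \<open>z\<close> below \<open>a\<close>.\<close>
  have compl: "inf (- z) a = inf (- (inf z a)) a" for z
    by (simp add: inf_sup_distrib2)
  have "inf (- x) a = inf (- s) a"
    using s(2) compl[of x] compl[of s] by simp
  then show "- x \<in> ?T"
    using subalgebra_closed(3)[OF assms s(1)] by blast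
next
  fix x y assume "x \<in> ?T" "y \<in> ?T"
  then obtain s t where st: "s \<in> S" "inf x a = inf s a" "t \<in> S" "inf y a = inf t a" by blast
  have "inf (inf x y) a = inf (inf s t) a"
    using st(2,4) by (metis inf.assoc inf.left_commute)
  moreover have "inf (sup x y) a = inf (sup s t) a"
    using st(2,4) by (simp add: inf_sup_distrib2)
  ultimately show "inf x y \<in> ?T" "sup x y \<in> ?T"
    using subalgebra_closed(4,5)[OF assms st(1,3)] by blast+
qed

lemma subalgebra_Int: "subalgebra S \<Longrightarrow> subalgebra T \<Longrightarrow> subalgebra (S \<inter> T)"
  by (auto simp: subalgebra_def)

text \<open>With a new generator \<open>a\<close>, every element is glued from an old element below
  \<open>a\<close> and an old element below \<open>- a\<close>. So the size is at most squared, and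
  the square of \<open>2 ^ 2 ^ n\<close> is \<open>2 ^ 2 ^ Suc n\<close>.\<close>

lemma finite_card_hull:
  assumes "finite X"
  shows "finite (subalgebra hull X) \<and> card (subalgebra hull X) \<le> 2 ^ 2 ^ card X"
  using assms
proof induction
  case empty
  have "subalgebra hull {} \<subseteq> {bot, top :: 'a}"
    by (rule hull_minimal) (auto simp: subalgebra_def)
  moreover have "card {bot, top :: 'a} \<le> 2"
    by (simp add: card_insert_if)
  ultimately show ?case
    by (auto dest: finite_subset card_mono[rotated])
next
  case (insert a X)
  let ?S = "subalgebra hull X" and ?f = "\<lambda>(s, t). sup (inf s a) (inf t (- a))"
  let ?T = "{x. \<exists>s\<in>?S. inf x a = inf s a} \<inter> {x. \<exists>s\<in>?S. inf x (- a) = inf s (- a)}"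
  have "a \<in> ?T"
    using subalgebra_closed(1,2)[OF subalgebra_hull[of X]] by force
  then have "insert a X \<subseteq> ?T"
    using hull_subset[of X subalgebra] by blast
  then have "subalgebra hull (insert a X) \<subseteq> ?T"
    by (intro hull_minimal subalgebra_Int subalgebra_relative subalgebra_hull)
  moreover have "?T \<subseteq> ?f ` (?S \<times> ?S)"
  proof
    fix x assume "x \<in> ?T"
    then obtain s t where st: "s \<in> ?S" "t \<in> ?S" "inf x a = inf s a" "inf x (- a) = inf t (- a)"
      by blast
    have "x = sup (inf x a) (inf x (- a))"
      by (simp flip: inf_sup_distrib1)
    then have "x = ?f (s, t)"
      using st by simp
    then show "x \<in> ?f ` (?S \<times> ?S)"
      using st by blast
  qed
  ultimately have sub: "subalgebra hull (insert a X) \<subseteq> ?f ` (?S \<times> ?S)"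
    by (rule order_trans)
  have fin: "finite (?S \<times> ?S)"
    using insert.IH by simp
  have "card (subalgebra hull (insert a X)) \<le> card (?S \<times> ?S)"
    using sub fin by (meson card_image_le card_mono finite_imageI le_trans)
  also have "\<dots> \<le> 2 ^ 2 ^ card X * 2 ^ 2 ^ card X"
    using insert.IH by (simp add: card_cartesian_product mult_mono)
  also have "\<dots> = 2 ^ 2 ^ card (insert a X)"
    using insert.hyps by (simp add: mult_2 flip: power_add)
  finally show ?case
    using sub fin finite_subset by blast
qed

text \<open>Take a generating subset of least cardinality: a redundant element could be dropped from
  it.\<close>

lemma finite_irredundant_generators:
  assumes "finite Z"
  obtains X where "X \<subseteq> Z" "irredundant X" "Z \<subseteq> subalgebra hull X"
proof -
  let ?P = "\<lambda>X. X \<subseteq> Z \<and> Z \<subseteq> subalgebra hull X"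
  have "?P Z" by (auto intro: hull_inc)
  then obtain X where X: "?P X" and min: "\<And>Y. ?P Y \<Longrightarrow> card X \<le> card Y"
    using ex_has_least_nat[of ?P Z card] by auto
  have "x \<notin> subalgebra hull (X - {x})" if x: "x \<in> X" for x
  proof
    assume *: "x \<in> subalgebra hull (X - {x})"
    have "X \<subseteq> subalgebra hull (X - {x})"
    proof
      fix y assume "y \<in> X"
      with * show "y \<in> subalgebra hull (X - {x})"
        by (cases "y = x") (auto intro: hull_inc)
    qed
    then have "subalgebra hull X \<subseteq> subalgebra hull (X - {x})"
      by (intro hull_minimal subalgebra_hull)
    then have "card X \<le> card (X - {x})"
      using X by (intro min) auto
    then show False
      using X x assms by (meson card_Diff1_less finite_subset linorder_not_le)
  qed
  then show thesis
    using X that by (auto simp: irredundant_def)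
qed

lemma infinite_irr:
  assumes "infinite (UNIV :: 'a::boolean_algebra set)"
  shows "infinite (Field (irr TYPE('a)))"
proof
  assume fin: "finite (Field (irr TYPE('a)))"
  let ?n = "card (Field (irr TYPE('a)))"
  \<comment> \<open>One element more than \<open>?n\<close> generators can produce.\<close>
  obtain Z :: "'a set" where Z: "finite Z" "card Z = Suc (2 ^ 2 ^ ?n)"
    using infinite_arbitrarily_large[OF assms] by blast
  obtain X where X: "X \<subseteq> Z" "irredundant X" "Z \<subseteq> subalgebra hull X"
    using finite_irredundant_generators[OF Z(1)] .
  have finX: "finite X"
    using X(1) Z(1) finite_subset by blast
  have "|X| \<le>o |Field (irr TYPE('a))|"
    using irredundant_card_le_irr[OF X(2)] card_of_Field_ordIso[OF Card_order_irr]
      ordIso_symmetric ordLeq_ordIso_trans by blast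
  then have "card X \<le> ?n"
    using fin finX by (metis card_of_ordLeq card_inj_on_le)
  then have "(2::nat) ^ 2 ^ card X \<le> 2 ^ 2 ^ ?n"
    by (intro power_increasing) auto
  moreover have "card Z \<le> 2 ^ 2 ^ card X"
    using finite_card_hull[OF finX] X(3) by (meson card_mono le_trans)
  ultimately show False
    using Z(2) by linarith
qed

section \<open>Free subsets for set mappings with finite values\<close>

lemma finite_ordLeq_infinite:
  assumes "infinite (Field r)" "Card_order r" "finite A"
  shows "|A| \<le>o r"
proof -
  have "|A| <o r"
    using assms card_of_Well_order[of A]
    by (intro finite_ordLess_infinite) (simp_all add: card_order_on_def[of "Field r"] Field_card_of)
  then show ?thesis
    by (rule ordLess_imp_ordLeq)
qed

lemma not_ordLeq_remove_point:
  assumes "infinite (Field r)" "Card_order r" "\<not> |X| \<le>o r"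
  shows "\<not> |X - {y}| \<le>o r"
proof
  assume *: "|X - {y}| \<le>o r"
  have "|{y}| \<le>o r"
    using assms(1,2) by (intro finite_ordLeq_infinite) auto
  with * have "|(X - {y}) \<union> {y}| \<le>o r"
    using assms(1,2) by (intro card_of_Un_ordLeq_infinite_Field)
  then have "|X| \<le>o r"
    by (rule ordLeq_transitive[rotated]) (auto intro: card_of_mono1)
  with assms(3) show False ..
qed

text \<open>
  A point \<open>y\<close> lying in many of the sets \<open>H x\<close> can be removed from all of them, which lowers the bound;
  if there is no such point, a maximal free set is large.
\<close>

lemma free_subset_bounded:
  assumes r: "infinite (Field r)" "Card_order r"
    and "\<not> |X| \<le>o r" "\<And>x. x \<in> X \<Longrightarrow> finite (H x) \<and> card (H x) \<le> n"
  shows "\<exists>Y\<subseteq>X. \<not> |Y| \<le>o r \<and> pairwise (\<lambda>x y. x \<notin> H y) Y"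
  using assms(3,4)
proof (induction n arbitrary: X H)
  case 0
  then have "H x = {}" if "x \<in> X" for x
    using that by fastforce
  then have "pairwise (\<lambda>x y. x \<notin> H y) X"
    by (auto simp: pairwise_def)
  with 0 show ?case by blast
next
  case (Suc n)
  show ?case
  proof (cases "\<exists>y. \<not> |{x \<in> X. y \<in> H x}| \<le>o r")
    case True
    then obtain y where y: "\<not> |{x \<in> X. y \<in> H x}| \<le>o r" by blast
    \<comment> \<open>Dropping \<open>y\<close> from the index set as well ensures that freeness for
      \<open>?H\<close> gives freeness for \<open>H\<close>.\<close>
    let ?X = "{x \<in> X. y \<in> H x} - {y}" and ?H = "\<lambda>x. H x - {y}"
    have "\<not> |?X| \<le>o r"
      using not_ordLeq_remove_point[OF r y] .
    moreover have "finite (?H x) \<and> card (?H x) \<le> n" if "x \<in> ?X" for x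
      using Suc.prems(2)[of x] that by auto
    ultimately obtain Y where Y: "Y \<subseteq> ?X" "\<not> |Y| \<le>o r" "pairwise (\<lambda>x z. x \<notin> ?H z) Y"
      using Suc.IH[of ?X ?H] by blast
    then have "pairwise (\<lambda>x z. x \<notin> H z) Y"
      by (auto simp: pairwise_def)
    with Y show ?thesis by blast
  next
    case False
    let ?F = "{Y. Y \<subseteq> X \<and> pairwise (\<lambda>x y. x \<notin> H y) Y}"
    have "\<exists>M\<in>?F. \<forall>Z\<in>?F. M \<subseteq> Z \<longrightarrow> Z = M"
    proof (rule subset_Zorn')
      fix C assume C: "subset.chain ?F C"
      then have "pairwise (\<lambda>x y. x \<notin> H y) (\<Union>C)"
        by (intro pairwise_chain_Union) (auto simp: subset_chain_def chain_subset_def)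
      with C show "\<Union>C \<in> ?F"
        by (auto simp: subset_chain_def)
    qed
    then obtain Y where "Y \<in> ?F" and "\<forall>Z\<in>?F. Y \<subseteq> Z \<longrightarrow> Z = Y"
      by (elim bexE)
    then have Y: "Y \<subseteq> X" "pairwise (\<lambda>x y. x \<notin> H y) Y"
      and max: "\<And>Z. Z \<subseteq> X \<Longrightarrow> pairwise (\<lambda>x y. x \<notin> H y) Z \<Longrightarrow> Y \<subseteq> Z \<Longrightarrow> Z = Y"
      by simp_all
    \<comment> \<open>A point outside all three sets could be added to the maximal free set
      \<open>Y\<close>. If \<open>Y\<close> were small, each of the three would be small, and so
      would \<open>X\<close>.\<close>
    have cover: "X \<subseteq> Y \<union> ((\<Union>y\<in>Y. {x \<in> X. y \<in> H x}) \<union> (\<Union>y\<in>Y. H y))"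
    proof
      fix x assume x: "x \<in> X"
      show "x \<in> Y \<union> ((\<Union>y\<in>Y. {x \<in> X. y \<in> H x}) \<union> (\<Union>y\<in>Y. H y))"
      proof (rule ccontr)
        assume *: "\<not> ?thesis"
        then have "pairwise (\<lambda>x y. x \<notin> H y) (insert x Y)"
          using Y x by (auto simp: pairwise_insert)
        then have "insert x Y = Y"
          using Y x by (intro max) auto
        with * show False by blast
      qed
    qed
    have "\<not> |Y| \<le>o r"
    proof
      assume le: "|Y| \<le>o r"
      have "|\<Union>y\<in>Y. {x \<in> X. y \<in> H x}| \<le>o r"
        using False by (intro card_of_UNION_ordLeq_infinite_Field[OF r le]) auto
      moreover have "|\<Union>y\<in>Y. H y| \<le>o r"
        using Suc.prems(2) Y(1) finite_ordLeq_infinite[OF r]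
        by (intro card_of_UNION_ordLeq_infinite_Field[OF r le]) blast
      ultimately have "|Y \<union> ((\<Union>y\<in>Y. {x \<in> X. y \<in> H x}) \<union> (\<Union>y\<in>Y. H y))| \<le>o r"
        using le r by (intro card_of_Un_ordLeq_infinite_Field)
      then have "|X| \<le>o r"
        using card_of_mono1[OF cover] ordLeq_transitive by blast
      with Suc.prems(1) show False ..
    qed
    with Y show ?thesis by blast
  qed
qed

text \<open>\<open>X\<close> is the countable union of the sets on which \<open>card (H x)\<close>
  is at most \<open>n\<close>. As \<open>r\<close> is infinite, one of these is already too large
  for \<open>r\<close>, and there the bounded case applies.\<close>

lemma free_subset:
  assumes r: "infinite (Field r)" "Card_order r"
    and X: "\<not> |X| \<le>o r" and fin: "\<And>x. x \<in> X \<Longrightarrow> finite (H x)"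
  obtains Y where "Y \<subseteq> X" "\<not> |Y| \<le>o r" "pairwise (\<lambda>x y. x \<notin> H y) Y"
proof -
  have "\<exists>n. \<not> |{x \<in> X. card (H x) \<le> n}| \<le>o r"
  proof (rule ccontr)
    assume "\<not> ?thesis"
    moreover have "|UNIV :: nat set| \<le>o r"
      using r infinite_iff_card_of_nat card_of_Field_ordIso ordLeq_ordIso_trans by blast
    ultimately have "|\<Union>n. {x \<in> X. card (H x) \<le> n}| \<le>o r"
      by (intro card_of_UNION_ordLeq_infinite_Field[OF r]) auto
    moreover have "(\<Union>n. {x \<in> X. card (H x) \<le> n}) = X" by auto
    ultimately show False using X by simp
  qed
  then obtain n where n: "\<not> |{x \<in> X. card (H x) \<le> n}| \<le>o r" by blast
  then show thesis
    using free_subset_bounded[OF r n, of H n] fin that by blast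
qed

section \<open>The product\<close>

text \<open>The bound \<open>r\<close> is left arbitrary, on a type of its own, so that the
  irredundance of either factor can be inserted for it.\<close>

lemma irr_prod_le:
  fixes r :: "'c rel"
  assumes r: "infinite (Field r)" "Card_order r"
    and A: "irr TYPE('a::boolean_algebra) \<le>o r" and B: "irr TYPE('b::boolean_algebra) \<le>o r"
  shows "irr TYPE('a \<times> 'b) \<le>o r"
  unfolding irr_def[where 'a = "'a \<times> 'b"]
proof (rule card_sup_least[OF r(2)])
  fix X :: "('a \<times> 'b) set" assume "X \<in> {X. irredundant X}"
  then have X: "x \<notin> subalgebra hull (X - {x})" if "x \<in> X" for x
    using that by (auto simp: irredundant_def)
  define R where "R = {x \<in> X. snd x \<in> snd ` (subalgebra hull (X - {x}))}"
  have "R \<subseteq> X" by (auto simp: R_def)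
  have "|X - R| \<le>o irr TYPE('b)"
  proof (rule card_le_irr[where f = snd], rule notI)
    fix x assume x: "x \<in> X - R" and "snd x \<in> subalgebra hull (snd ` (X - R - {x}))"
    then have "snd x \<in> snd ` (subalgebra hull (X - R - {x}))"
      using hull_image_snd_subset by blast
    then have "snd x \<in> snd ` (subalgebra hull (X - {x}))"
      using hull_mono[of "X - R - {x}" "X - {x}" subalgebra] by blast
    with x show False by (auto simp: R_def)
  qed
  then have XR: "|X - R| \<le>o r"
    using B ordLeq_transitive by blast
  have "|R| \<le>o r"
  proof (cases "(top, bot) \<in> subalgebra hull X")
    case True
    then obtain F where F: "finite F" "F \<subseteq> X" "(top, bot) \<in> subalgebra hull F"
      by (rule hull_finite_support)
    have "|R - F| \<le>o irr TYPE('a)"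
    proof (rule card_le_irr[where f = fst], rule notI)
      fix x assume x: "x \<in> R - F" and "fst x \<in> subalgebra hull (fst ` (R - F - {x}))"
      then have "fst x \<in> fst ` (subalgebra hull (R - F - {x}))"
        using hull_image_fst_subset by blast
      let ?S = "subalgebra hull (X - {x})"
      obtain c d where c: "c \<in> ?S" "fst x = fst c" and d: "d \<in> ?S" "snd x = snd d"
        using \<open>fst x \<in> fst ` _\<close> x \<open>R \<subseteq> X\<close> hull_mono[of "R - F - {x}" "X - {x}" subalgebra]
        unfolding R_def by blast
      \<comment> \<open>\<open>F\<close> avoids \<open>x\<close>, so its hull survives the removal
        of \<open>x\<close>.\<close>
      have "(top, bot) \<in> ?S"
        using F x hull_mono[of F "X - {x}" subalgebra] by blast
      \<comment> \<open>The first coordinate is taken from \<open>c\<close>, the second from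
        \<open>d\<close>.\<close>
      then have "sup (inf c (top, bot)) (inf d (- (top, bot))) \<in> ?S"
        using c d by (simp add: subalgebra_closed[OF subalgebra_hull] del: uminus_Pair)
      moreover have "sup (inf c (top, bot)) (inf d (- (top, bot))) = x"
        using c d by (intro prod_eqI) auto
      ultimately have "x \<in> ?S" by simp
      then show False
        using X x \<open>R \<subseteq> X\<close> by blast
    qed
    then have "|R - F| \<le>o r"
      using A ordLeq_transitive by blast
    then have "|(R - F) \<union> F| \<le>o r"
      using finite_ordLeq_infinite[OF r F(1)] r by (intro card_of_Un_ordLeq_infinite_Field)
    then show ?thesis
      by (rule ordLeq_transitive[rotated]) (auto intro: card_of_mono1)
  next
    case False
    have "\<exists>d F. finite F \<and> F \<subseteq> X - {x} \<and> d \<in> subalgebra hull F \<and> snd d = snd x" if x: "x \<in> R" for x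
    proof -
      obtain d where d: "d \<in> subalgebra hull (X - {x})" "snd d = snd x"
        using x unfolding R_def by force
      from d(1) show ?thesis
        by (rule hull_finite_support) (use d(2) in blast)
    qed
    then obtain d F where F: "\<And>x. x \<in> R \<Longrightarrow> finite (F x)" "\<And>x. x \<in> R \<Longrightarrow> F x \<subseteq> X - {x}"
      and d: "\<And>x. x \<in> R \<Longrightarrow> d x \<in> subalgebra hull F x" "\<And>x. x \<in> R \<Longrightarrow> snd (d x) = snd x"
      by metis
    define g where "g x = bxor x (d x)" for x
    have snd_g: "snd (g x) = bot" if "x \<in> R" for x
      using that d(2) by (simp add: g_def snd_bxor)
    show ?thesis
    proof (rule ccontr)
      assume "\<not> |R| \<le>o r"
      then obtain Y where Y: "Y \<subseteq> R" "\<not> |Y| \<le>o r" "pairwise (\<lambda>x y. x \<notin> F y) Y"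
        using free_subset[OF r, of R F] F(1) by blast
      have "|Y| \<le>o irr TYPE('a)"
      proof (rule card_le_irr[where f = "fst \<circ> g"], rule notI)
        fix x assume x: "x \<in> Y" and "(fst \<circ> g) x \<in> subalgebra hull ((fst \<circ> g) ` (Y - {x}))"
        then have "fst (g x) \<in> fst ` (subalgebra hull (g ` (Y - {x})))"
          using hull_image_fst_subset[of "g ` (Y - {x})"] by (auto simp: image_comp)
        then obtain h where h: "h \<in> subalgebra hull (g ` (Y - {x}))" "fst h = fst (g x)"
          by force
        let ?S = "subalgebra hull (X - {x})"
        have dx: "d x \<in> ?S"
          using d(1)[of x] F(2)[of x] x Y(1) hull_mono[of "F x" "X - {x}" subalgebra] by blast
        have "g y \<in> ?S" if y: "y \<in> Y - {x}" for y
        proof -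
          \<comment> \<open>\<open>F y\<close> was chosen to avoid \<open>y\<close>; that it also
            avoids \<open>x\<close> is the freeness of \<open>Y\<close>.\<close>
          have "F y \<subseteq> X - {x}"
            using F(2)[of y] Y x y by (auto simp: pairwise_def)
          then have "d y \<in> ?S"
            using d(1)[of y] Y(1) y hull_mono[of "F y" "X - {x}" subalgebra] by blast
          moreover have "y \<in> ?S"
            using y Y(1) \<open>R \<subseteq> X\<close> by (auto intro: hull_inc)
          ultimately show ?thesis
            unfolding g_def by (intro subalgebra_bxor subalgebra_hull)
        qed
        then have "subalgebra hull (g ` (Y - {x})) \<subseteq> ?S"
          by (intro hull_minimal subalgebra_hull image_subsetI)
        with h have hS: "h \<in> ?S" by blast
        \<comment> \<open>All generators \<open>g y\<close> have second coordinate
          \<open>bot\<close>, so those of generated elements lie in the two-element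
          subalgebra.\<close>
        have "subalgebra (snd -` {bot, top :: 'b})"
          by (intro subalgebra_vimage_snd) (auto simp: subalgebra_def)
        then have "subalgebra hull (g ` (Y - {x})) \<subseteq> snd -` {bot, top :: 'b}"
          using snd_g Y(1) by (intro hull_minimal) auto
        with h have "snd h = bot \<or> snd h = top" by blast
        then show False
        proof
          assume "snd h = bot"
          then have "h = g x"
            using h(2) snd_g[of x] x Y(1) by (intro prod_eqI) auto
          then have "bxor (d x) h = x"
            by (simp add: g_def bxor.xor.commute[of x])
          then have "x \<in> ?S"
            using subalgebra_bxor[OF subalgebra_hull dx hS] by simp
          then show False
            using X x Y(1) \<open>R \<subseteq> X\<close> by blast
        next
          assume top: "snd h = top"
          have sub: "?S \<subseteq> subalgebra hull X"
            by (intro hull_mono) auto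
          have "x \<in> subalgebra hull X"
            using x Y(1) \<open>R \<subseteq> X\<close> by (auto intro: hull_inc)
          then have "g x \<in> subalgebra hull X"
            unfolding g_def using dx sub by (intro subalgebra_bxor subalgebra_hull) auto
          then have "- bxor h (g x) \<in> subalgebra hull X"
            using hS sub by (intro subalgebra_closed(3) subalgebra_bxor subalgebra_hull) auto
          \<comment> \<open>\<open>h\<close> and \<open>g x\<close> agree in the first coordinate
            and are complementary in the second. This contradicts the case assumption that
            \<open>(top, bot)\<close> is not generated.\<close>
          moreover have "- bxor h (g x) = (top, bot)"
            using h(2) top snd_g[of x] x Y(1) by (intro prod_eqI) (auto simp: fst_bxor snd_bxor)
          ultimately show False
            using False by simp
        qed
      qed
      with A Y(2) show False
        using ordLeq_transitive by blast
    qed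
  qed
  with XR have "|(X - R) \<union> R| \<le>o r"
    using r by (intro card_of_Un_ordLeq_infinite_Field)
  then show "|X| \<le>o r"
    by (rule ordLeq_transitive[rotated]) (auto intro: card_of_mono1)
qed

text \<open>Finite algebras behave differently: in the two-element algebra only the empty set is
  irredundant, while in its square the singleton of \<open>(top, bot)\<close> is irredundant
  too.\<close>

theorem theorem2p1:
  assumes "infinite (UNIV :: 'a::boolean_algebra set) \<or> infinite (UNIV :: 'b::boolean_algebra set)"
  shows "irr TYPE('a \<times> 'b) =o card_max (irr TYPE('a)) (irr TYPE('b))"
proof -
  let ?a = "irr TYPE('a)" and ?b = "irr TYPE('b)" and ?p = "irr TYPE('a \<times> 'b)"
  have inf: "infinite (Field ?a) \<or> infinite (Field ?b)"
    using assms infinite_irr[where 'a = 'a] infinite_irr[where 'a = 'b] by argo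
  have wo: "Well_order ?a" "Well_order ?b"
    using Card_order_irr by (auto simp: card_order_on_def)
  have max: "?a \<le>o ?b \<Longrightarrow> card_max ?a ?b =o ?b" "?b \<le>o ?a \<Longrightarrow> card_max ?a ?b =o ?a"
    using card_max_ordIso[OF Card_order_irr Card_order_irr] by auto
  consider (ab) "?a \<le>o ?b" | (ba) "?b \<le>o ?a"
    using ordLeq_total[OF wo] by blast
  then show ?thesis
  proof cases
    case ab
    \<comment> \<open>Whichever of the two cardinals is infinite, the larger one is.\<close>
    then have "infinite (Field ?b)"
      using inf wo card_of_mono2 card_of_ordLeq_infinite by blast
    then have "?p \<le>o ?b"
      using ab Card_order_irr ordLeq_refl by (intro irr_prod_le) auto
    then have "?p =o ?b"
      using irr_snd_le by (simp add: ordIso_iff_ordLeq)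
    then show ?thesis
      using max(1)[OF ab] ordIso_symmetric ordIso_transitive by blast
  next
    case ba
    then have "infinite (Field ?a)"
      using inf wo card_of_mono2 card_of_ordLeq_infinite by blast
    then have "?p \<le>o ?a"
      using ba Card_order_irr ordLeq_refl by (intro irr_prod_le) auto
    then have "?p =o ?a"
      using irr_fst_le by (simp add: ordIso_iff_ordLeq)
    then show ?thesis
      using max(2)[OF ba] ordIso_symmetric ordIso_transitive by blast
  qed
qed

end
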